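(* Let $\mathcal G^0$ be an undirected graph with $N$ vertices, let $\lambda_1,\dots,\lambda_N$ be the eigenvalues of its Laplacian $L^0=L(\mathcal G^0)$, and let $A^d,A^c\in\mathbb R^{n_x\times n_x}$, $B^d,B^c\in\mathbb R^{n_x\times n_w}$, $C^d,C^c\in\mathbb R^{n_z\times n_x}$, $D^d,D^c\in\mathbb R^{n_z\times n_w}$. Fix a symmetric $Q\in\mathbb R^{n_x\times n_x}$ with $Q\succ0$ and symmetric $Z_1,\dots,Z_N\in\mathbb R^{n_w\times n_w}$. Let $M_i(p)$, for $p\in[0,1]$ and $i\in\{1,\dots,N\}$, be given by one of the following three expressions (the same one for all $i$): (a) $M_i(p)=(A^d+p\lambda_iA^c)^TQ(A^d+p\lambda_iA^c)-Q+2p(1-p)\lambda_iA^{cT}QA^c$; (b) $M_i(p)=(A^d+p\lambda_iA^c)^TQ(A^d+p\lambda_iA^c)+(C^d+p\lambda_iC^c)^T(C^d+p\lambda_iC^c)-Q+2p(1-p)\lambda_i\big(A^{cT}QA^c+C^{cT}C^c\big)$; (c) $M_i(p)=(B^d+p\lambda_iB^c)^TQ(B^d+p\lambda_iB^c)+(D^d+p\lambda_iD^c)^T(D^d+p\lambda_iD^c)-Z_i+2p(1-p)\lambda_i\big(B^{cT}QB^c+D^{cT}D^c\big)$. Define $V_i(p,y)=y^TM_i(p)y$. Then $V_i(p,y)$ is convex in $p$ (for every vector $y$) for all $i\in\{1,\dots,N\}$ if and only if either the relevant coupling matrices are zero matrices (that is, $A^c=0$ in case (a); $A^c=0$ and $C^c=0$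 in case (b); $B^c=0$ and $D^c=0$ in case (c)) or all non-zero eigenvalues of $L^0$ satisfy $\lambda_i\ge2$.
   Context: A graph $\mathcal G=(\mathcal V,\mathcal E)$ has vertex set $\mathcal V=\{v_1,\dots,v_N\}$ and edge set $\mathcal E\subset\mathcal V\times\mathcal V$ without self-loops, where $e_{ij}=(v_j,v_i)$ is the edge from $v_j$ to $v_i$; it is undirected if $e_{ij}\in\mathcal E\Leftrightarrow e_{ji}\in\mathcal E$. With $\mathcal N_i^-=\{v_j:e_{ij}\in\mathcal E\}$ and $d_i^-=|\mathcal N_i^-|$, the Laplacian $L(\mathcal G)=[l_{ij}]$ has $l_{ij}=-1$ if $i\ne j$ and $v_j\in\mathcal N_i^-$, $l_{ij}=0$ if $i\ne j$ and $v_j\notin\mathcal N_i^-$, $l_{ii}=d_i^-$. $Q\succ0$ means symmetric positive definite; $A^{cT}=(A^c)^T$ and similarly for the other matrices. *)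

theory Defs
  imports
    "HOL-Analysis.Convex"
    "Jordan_Normal_Form.Char_Poly"
    "Graph_Theory.Pair_Digraph"
begin

text \<open>
  The vertices of a graph with \<open>N\<close> vertices are the indices \<open>0, \<dots>, N - 1\<close>.
  An arc \<open>(j, i)\<close> points from \<open>j\<close> to \<open>i\<close>.
\<close>

definition in_neighbours :: "'a pair_pre_digraph \<Rightarrow> 'a \<Rightarrow> 'a set" where
  "in_neighbours G i = {j. (j, i) \<in> parcs G}"

definition laplacian :: "nat \<Rightarrow> nat pair_pre_digraph \<Rightarrow> real mat" where
  "laplacian N G = mat N N (\<lambda>(i, j).
     if i = j then real (card (in_neighbours G i))
     else if j \<in> in_neighbours G i then - 1 else 0)"

definition sym_mat :: "nat \<Rightarrow> real mat \<Rightarrow> bool" where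
  "sym_mat n Q \<longleftrightarrow> Q \<in> carrier_mat n n \<and> Q\<^sup>T = Q"

definition pos_def_mat :: "nat \<Rightarrow> real mat \<Rightarrow> bool" where
  "pos_def_mat n Q \<longleftrightarrow> sym_mat n Q \<and>
     (\<forall>x \<in> carrier_vec n. x \<noteq> 0\<^sub>v n \<longrightarrow> x \<bullet> (Q *\<^sub>v x) > 0)"

text \<open>In the following, \<open>l\<close> is a Laplacian eigenvalue.\<close>

definition M_a :: "real mat \<Rightarrow> real mat \<Rightarrow> real mat \<Rightarrow> real \<Rightarrow> real \<Rightarrow> real mat" where
  "M_a Ad Ac Q l p =
     (Ad + (p * l) \<cdot>\<^sub>m Ac)\<^sup>T * Q * (Ad + (p * l) \<cdot>\<^sub>m Ac) - Q
     + (2 * p * (1 - p) * l) \<cdot>\<^sub>m (Ac\<^sup>T * Q * Ac)"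

definition M_b ::
  "real mat \<Rightarrow> real mat \<Rightarrow> real mat \<Rightarrow> real mat \<Rightarrow> real mat \<Rightarrow> real \<Rightarrow> real \<Rightarrow> real mat" where
  "M_b Ad Ac Cd Cc Q l p =
     (Ad + (p * l) \<cdot>\<^sub>m Ac)\<^sup>T * Q * (Ad + (p * l) \<cdot>\<^sub>m Ac)
     + (Cd + (p * l) \<cdot>\<^sub>m Cc)\<^sup>T * (Cd + (p * l) \<cdot>\<^sub>m Cc) - Q
     + (2 * p * (1 - p) * l) \<cdot>\<^sub>m (Ac\<^sup>T * Q * Ac + Cc\<^sup>T * Cc)"

definition M_c ::
  "real mat \<Rightarrow> real mat \<Rightarrow> real mat \<Rightarrow> real mat \<Rightarrow> real mat \<Rightarrow> real mat \<Rightarrow> real \<Rightarrow> real \<Rightarrow> real mat" where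
  "M_c Bd Bc Dd Dc Q Z l p =
     (Bd + (p * l) \<cdot>\<^sub>m Bc)\<^sup>T * Q * (Bd + (p * l) \<cdot>\<^sub>m Bc)
     + (Dd + (p * l) \<cdot>\<^sub>m Dc)\<^sup>T * (Dd + (p * l) \<cdot>\<^sub>m Dc) - Z
     + (2 * p * (1 - p) * l) \<cdot>\<^sub>m (Bc\<^sup>T * Q * Bc + Dc\<^sup>T * Dc)"

definition V :: "(real \<Rightarrow> real mat) \<Rightarrow> real \<Rightarrow> real vec \<Rightarrow> real" where
  "V M p y = y \<bullet> (M p *\<^sub>v y)"

end

theory Submission
  imports Defs
begin

text \<open>
  Each \<open>V\<^sub>i\<close> is a quadratic polynomial in \<open>p\<close>, and its leading coefficient is
  \<open>\<lambda>\<^sub>i (\<lambda>\<^sub>i - 2)\<close> times a positive semidefinite form in \<open>y\<close> that vanishes identically exactly when the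
  coupling matrices are zero. Convexity means that this coefficient is nonnegative, and Laplacian
  eigenvalues are nonnegative because the Laplacian is diagonally dominant. Cases (a) and (b) are the
  instances of case (c) with \<open>Z = Q\<close> and, for (a), with output matrices that have no rows.
\<close>

section \<open>Convexity of real quadratic polynomials\<close>

text \<open>The defect of the convexity inequality at weight \<open>t\<close> between
  \<open>x\<close> and \<open>y\<close> is \<open>c * (t * (1 - t)) * (x - y)\<^sup>2\<close>, which
  settles one direction. Conversely, the midpoint of 0 and 1 alone forces \<open>c / 4\<close> to be
  nonnegative.\<close>

lemma convex_on_quadratic_iff:
  fixes a b c :: real
  shows "convex_on {0..1} (\<lambda>p. a + b * p + c * p\<^sup>2) \<longleftrightarrow> 0 \<le> c"
proof
  assume "convex_on {0..1} (\<lambda>p. a + b * p + c * p\<^sup>2)"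
  from convex_onD[OF this, of "1/2" 0 1] show "0 \<le> c"
    by (simp add: power2_eq_square field_simps)
next
  assume c: "0 \<le> c"
  show "convex_on {0..1} (\<lambda>p. a + b * p + c * p\<^sup>2)"
  proof (rule convex_onI)
    fix t x y :: real
    assume t: "0 < t" "t < 1"
    have "(1 - t) * (a + b * x + c * x\<^sup>2) + t * (a + b * y + c * y\<^sup>2)
        - (a + b * ((1 - t) * x + t * y) + c * ((1 - t) * x + t * y)\<^sup>2)
        = c * (t * (1 - t)) * (x - y)\<^sup>2"
      by (simp add: power2_eq_square algebra_simps)
    also have "\<dots> \<ge> 0"
      using c t by simp
    finally show "a + b * ((1 - t) *\<^sub>R x + t *\<^sub>R y) + c * ((1 - t) *\<^sub>R x + t *\<^sub>R y)\<^sup>2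
        \<le> (1 - t) * (a + b * x + c * x\<^sup>2) + t * (a + b * y + c * y\<^sup>2)"
      by simp
  qed simp
qed

section \<open>Spectrum of the Laplacian\<close>

text \<open>A Gershgorin argument: in the row of an eigenvector entry of largest modulus, the
  diagonal entry equals the sum of the moduli of the other entries, so \<open>l\<close> lies within
  that distance of the degree.\<close>

lemma eigenvalue_laplacian_nonneg:
  assumes graph: "pair_graph G" "pverts G = {..<N}"
    and ev: "eigenvalue (laplacian N G) l"
  shows "0 \<le> l"
proof -
  interpret pair_graph G by fact
  let ?L = "laplacian N G"
  have L: "?L \<in> carrier_mat N N"
    by (simp add: laplacian_def)
  obtain x where x: "x \<in> carrier_vec N" "x \<noteq> 0\<^sub>v N" "?L *\<^sub>v x = l \<cdot>\<^sub>v x"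
    using ev L unfolding eigenvalue_def eigenvector_def by auto
  obtain k where k: "k < N" "x $ k \<noteq> 0"
    using x(1,2) by (metis carrier_vecD eq_vecI index_zero_vec)
  define m where "m = Max ((\<lambda>j. \<bar>x $ j\<bar>) ` {..<N})"
  have le_m: "\<bar>x $ j\<bar> \<le> m" if "j < N" for j
    unfolding m_def using that by (intro Max_ge) auto
  have "m \<in> (\<lambda>j. \<bar>x $ j\<bar>) ` {..<N}"
    unfolding m_def using k(1) by (intro Max_in) auto
  then obtain i where i: "i < N" "m = \<bar>x $ i\<bar>"
    by auto
  have m: "0 < m"
    using le_m[OF k(1)] k(2) by linarith
  let ?S = "in_neighbours G i"
  have S: "?S \<subseteq> {..<N}" "i \<notin> ?S"
    using graph(2) in_arcsD1 no_loops'[of i i] by (auto simp: in_neighbours_def)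
  have "l * x $ i = (?L *\<^sub>v x) $ i"
    using x i by simp
  also have "\<dots> = (\<Sum>j<N. ?L $$ (i, j) * x $ j)"
    using L x(1) i(1) by (simp add: scalar_prod_def atLeast0LessThan)
  \<comment> \<open>The row splits into its degree part and its adjacency part; since
    \<open>i \<notin> ?S\<close>, the two never overlap.\<close>
  also have "\<dots> = (\<Sum>j<N. (if j = i then card ?S * x $ i else 0) - (if j \<in> ?S then x $ j else 0))"
    using i(1) S by (intro sum.cong) (auto simp: laplacian_def)
  also have "\<dots> = card ?S * x $ i - (\<Sum>j\<in>?S. x $ j)"
    using i(1) S(1) by (simp add: sum_subtractf sum.inter_restrict[symmetric] Int_absorb1)
  finally have "(card ?S - l) * x $ i = (\<Sum>j\<in>?S. x $ j)"
    by (simp add: algebra_simps)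
  moreover have "\<bar>\<Sum>j\<in>?S. x $ j\<bar> \<le> card ?S * m"
  proof -
    have "\<bar>\<Sum>j\<in>?S. x $ j\<bar> \<le> (\<Sum>j\<in>?S. \<bar>x $ j\<bar>)"
      by (rule sum_abs)
    also have "\<dots> \<le> card ?S * m"
      using S le_m by (intro sum_bounded_above) auto
    finally show ?thesis .
  qed
  \<comment> \<open>Cancelling \<open>m > 0\<close> leaves
    \<open>\<bar>card ?S - l\<bar> \<le> card ?S\<close>, which rules out negative
    \<open>l\<close>.\<close>
  ultimately have "\<bar>card ?S - l\<bar> * m \<le> card ?S * m"
    by (simp add: i(2) flip: abs_mult)
  then show ?thesis
    using m by simp
qed

section \<open>Quadratic forms of matrices and pencils\<close>

lemma smult_mat_mult_vec:
  fixes A :: "real mat"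
  assumes "A \<in> carrier_mat m n" "v \<in> carrier_vec n"
  shows "(c \<cdot>\<^sub>m A) *\<^sub>v v = c \<cdot>\<^sub>v (A *\<^sub>v v)"
  using assms by (intro eq_vecI) auto

lemma quadratic_form_linear:
  fixes A B :: "real mat"
  assumes "A \<in> carrier_mat n n" "B \<in> carrier_mat n n" "y \<in> carrier_vec n"
  shows "y \<bullet> ((A + B) *\<^sub>v y) = y \<bullet> (A *\<^sub>v y) + y \<bullet> (B *\<^sub>v y)"
    and "y \<bullet> ((A - B) *\<^sub>v y) = y \<bullet> (A *\<^sub>v y) - y \<bullet> (B *\<^sub>v y)"
    and "y \<bullet> ((c \<cdot>\<^sub>m A) *\<^sub>v y) = c * (y \<bullet> (A *\<^sub>v y))"
  using assms
  by (simp_all add: add_mult_distrib_mat_vec[of _ n n] minus_mult_distrib_mat_vec[of _ n n]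
      smult_mat_mult_vec[of _ n n] scalar_prod_add_distrib[of _ n] scalar_prod_minus_distrib[of _ n])

lemma scalar_prod_congruence:
  fixes Q X :: "real mat"
  assumes "X \<in> carrier_mat m n" "Q \<in> carrier_mat m m" "y \<in> carrier_vec n"
  shows "y \<bullet> ((X\<^sup>T * Q * X) *\<^sub>v y) = (X *\<^sub>v y) \<bullet> (Q *\<^sub>v (X *\<^sub>v y))"
proof -
  have "y \<bullet> ((X\<^sup>T * Q * X) *\<^sub>v y) = (X\<^sup>T *\<^sub>v (Q *\<^sub>v (X *\<^sub>v y))) \<bullet> y"
    using assms by (subst comm_scalar_prod[of _ n]) (auto simp: assoc_mult_mat_vec[of _ n m _ n])
  also have "\<dots> = (Q *\<^sub>v (X *\<^sub>v y)) \<bullet> (X *\<^sub>v y)"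
    using assms by (intro transpose_vec_mult_scalar) auto
  also have "\<dots> = (X *\<^sub>v y) \<bullet> (Q *\<^sub>v (X *\<^sub>v y))"
    using assms by (intro comm_scalar_prod[of _ m]) auto
  finally show ?thesis .
qed

text \<open>This is the bilinear expansion of the form of \<open>Q\<close> at
  \<open>E y + r K y\<close>. The leading coefficient is left as the form of
  \<open>K\<^sup>T * Q * K\<close>, so that it merges with the last term of
  \<open>M_c\<close>.\<close>

lemma quadratic_form_pencil:
  fixes E K Q :: "real mat"
  assumes "E \<in> carrier_mat m n" "K \<in> carrier_mat m n" "Q \<in> carrier_mat m m" "y \<in> carrier_vec n"
  shows "y \<bullet> (((E + r \<cdot>\<^sub>m K)\<^sup>T * Q * (E + r \<cdot>\<^sub>m K)) *\<^sub>v y)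
    = (E *\<^sub>v y) \<bullet> (Q *\<^sub>v (E *\<^sub>v y))
      + r * ((E *\<^sub>v y) \<bullet> (Q *\<^sub>v (K *\<^sub>v y)) + (K *\<^sub>v y) \<bullet> (Q *\<^sub>v (E *\<^sub>v y)))
      + r\<^sup>2 * (y \<bullet> ((K\<^sup>T * Q * K) *\<^sub>v y))"
proof -
  have X: "(E + r \<cdot>\<^sub>m K) *\<^sub>v y = E *\<^sub>v y + r \<cdot>\<^sub>v (K *\<^sub>v y)"
    using assms by (simp add: add_mult_distrib_mat_vec[of _ m n] smult_mat_mult_vec[of _ m n])
  have QX: "Q *\<^sub>v (E *\<^sub>v y + r \<cdot>\<^sub>v (K *\<^sub>v y)) = Q *\<^sub>v (E *\<^sub>v y) + r \<cdot>\<^sub>v (Q *\<^sub>v (K *\<^sub>v y))"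
    using assms by (simp add: mult_add_distrib_mat_vec[of _ m m] mult_mat_vec[of _ m m])
  have "y \<bullet> (((E + r \<cdot>\<^sub>m K)\<^sup>T * Q * (E + r \<cdot>\<^sub>m K)) *\<^sub>v y)
      = (E *\<^sub>v y + r \<cdot>\<^sub>v (K *\<^sub>v y)) \<bullet> (Q *\<^sub>v (E *\<^sub>v y) + r \<cdot>\<^sub>v (Q *\<^sub>v (K *\<^sub>v y)))"
    using assms by (simp add: scalar_prod_congruence[of _ m n] X QX)
  also have "\<dots> = (E *\<^sub>v y) \<bullet> (Q *\<^sub>v (E *\<^sub>v y))
      + r * ((E *\<^sub>v y) \<bullet> (Q *\<^sub>v (K *\<^sub>v y)) + (K *\<^sub>v y) \<bullet> (Q *\<^sub>v (E *\<^sub>v y)))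
      + r\<^sup>2 * ((K *\<^sub>v y) \<bullet> (Q *\<^sub>v (K *\<^sub>v y)))"
    using assms
    by (simp add: add_scalar_prod_distrib[of _ m] scalar_prod_add_distrib[of _ m]
        algebra_simps power2_eq_square)
  finally show ?thesis
    unfolding scalar_prod_congruence[OF assms(2-4)] .
qed

text \<open>In the coefficient \<open>l (l - 2)\<close>, \<open>l\<^sup>2\<close> comes from the squares and \<open>- 2 l\<close> from the last term
  \<open>2 p (1 - p) l\<close> of \<open>M_c\<close>.\<close>

lemma V_M_c_quadratic:
  assumes B: "Bd \<in> carrier_mat m n" "Bc \<in> carrier_mat m n"
    and D: "Dd \<in> carrier_mat k n" "Dc \<in> carrier_mat k n"
    and Q: "Q \<in> carrier_mat m m" and Z: "Z \<in> carrier_mat n n" and y: "y \<in> carrier_vec n"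
  obtains a b where "\<And>p. V (M_c Bd Bc Dd Dc Q Z l) p y
    = a + b * p + l * (l - 2) * (y \<bullet> ((Bc\<^sup>T * Q * Bc + Dc\<^sup>T * Dc) *\<^sub>v y)) * p\<^sup>2"
proof -
  \<comment> \<open>The inserted \<open>1\<^sub>m k\<close> gives the output terms the same
    congruence shape as the terms with \<open>Q\<close>, so the pencil expansion with
    \<open>r = p * l\<close> covers both.\<close>
  have eq: "V (M_c Bd Bc Dd Dc Q Z l) p y
      = y \<bullet> (((Bd + (p * l) \<cdot>\<^sub>m Bc)\<^sup>T * Q * (Bd + (p * l) \<cdot>\<^sub>m Bc)) *\<^sub>v y)
        + y \<bullet> (((Dd + (p * l) \<cdot>\<^sub>m Dc)\<^sup>T * 1\<^sub>m k * (Dd + (p * l) \<cdot>\<^sub>m Dc)) *\<^sub>v y)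
        - y \<bullet> (Z *\<^sub>v y)
        + 2 * p * (1 - p) * l * (y \<bullet> ((Bc\<^sup>T * Q * Bc) *\<^sub>v y) + y \<bullet> ((Dc\<^sup>T * 1\<^sub>m k * Dc) *\<^sub>v y))" for p
  proof -
    have "((Bd + (p * l) \<cdot>\<^sub>m Bc)\<^sup>T * Q * (Bd + (p * l) \<cdot>\<^sub>m Bc)) \<in> carrier_mat n n"
      "((Dd + (p * l) \<cdot>\<^sub>m Dc)\<^sup>T * (Dd + (p * l) \<cdot>\<^sub>m Dc)) \<in> carrier_mat n n"
      "Bc\<^sup>T * Q * Bc \<in> carrier_mat n n" "Dc\<^sup>T * Dc \<in> carrier_mat n n"
      "(Dd + (p * l) \<cdot>\<^sub>m Dc)\<^sup>T * 1\<^sub>m k = (Dd + (p * l) \<cdot>\<^sub>m Dc)\<^sup>T"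
      "Dc\<^sup>T * 1\<^sub>m k = Dc\<^sup>T"
      using assms by (auto intro!: right_mult_one_mat)
    with y Z show ?thesis
      unfolding V_def M_c_def
      by (simp only: quadratic_form_linear[of _ n] add_carrier_mat minus_carrier_mat
          smult_carrier_mat)
  qed
  show thesis
  proof
    fix p
    let ?q = "\<lambda>Q u v. u \<bullet> (Q *\<^sub>v v) :: real"
    let ?a = "?q Q (Bd *\<^sub>v y) (Bd *\<^sub>v y) + ?q (1\<^sub>m k) (Dd *\<^sub>v y) (Dd *\<^sub>v y) - y \<bullet> (Z *\<^sub>v y)"
    let ?x = "?q Q (Bd *\<^sub>v y) (Bc *\<^sub>v y) + ?q Q (Bc *\<^sub>v y) (Bd *\<^sub>v y)"
    let ?z = "?q (1\<^sub>m k) (Dd *\<^sub>v y) (Dc *\<^sub>v y) + ?q (1\<^sub>m k) (Dc *\<^sub>v y) (Dd *\<^sub>v y)"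
    let ?s = "y \<bullet> ((Bc\<^sup>T * Q * Bc) *\<^sub>v y)"
    let ?t = "y \<bullet> ((Dc\<^sup>T * 1\<^sub>m k * Dc) *\<^sub>v y)"
    have "Bc\<^sup>T * Q * Bc \<in> carrier_mat n n" "Dc\<^sup>T * Dc \<in> carrier_mat n n" "Dc\<^sup>T * 1\<^sub>m k = Dc\<^sup>T"
      using assms by (auto intro!: right_mult_one_mat)
    then have st: "y \<bullet> ((Bc\<^sup>T * Q * Bc + Dc\<^sup>T * Dc) *\<^sub>v y) = ?s + ?t"
      using y by (simp add: quadratic_form_linear[of _ n])
    \<comment> \<open>In the linear coefficient, the cross terms contribute
      \<open>l * (?x + ?z)\<close>, and the part \<open>2 * p * l\<close> of
      \<open>2 * p * (1 - p) * l\<close> contributes the rest.\<close>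
    show "V (M_c Bd Bc Dd Dc Q Z l) p y
      = ?a + (l * (?x + ?z) + 2 * l * (?s + ?t)) * p
        + l * (l - 2) * (y \<bullet> ((Bc\<^sup>T * Q * Bc + Dc\<^sup>T * Dc) *\<^sub>v y)) * p\<^sup>2"
      unfolding eq st quadratic_form_pencil[OF B Q y] quadratic_form_pencil[OF D one_carrier_mat y]
      by (simp add: power2_eq_square algebra_simps)
  qed
qed

section \<open>Definiteness of the coupling form\<close>

lemma pos_def_mat_nonneg:
  assumes "pos_def_mat n Q" "x \<in> carrier_vec n"
  shows "0 \<le> x \<bullet> (Q *\<^sub>v x)"
  using assms by (cases "x = 0\<^sub>v n") (auto simp: pos_def_mat_def sym_mat_def intro: less_imp_le)

lemma pos_def_one_mat: "pos_def_mat n (1\<^sub>m n)"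
proof -
  have "0 < x \<bullet> x" if "x \<in> carrier_vec n" "x \<noteq> 0\<^sub>v n" for x :: "real vec"
    using conjugate_square_greater_0_vec[OF that(1)] that(2) by simp
  then show ?thesis
    by (simp add: pos_def_mat_def sym_mat_def)
qed

text \<open>Unit vectors pick out the columns of \<open>K\<close>.\<close>

lemma eq_zero_mat_if_mult_vec_zero:
  fixes K :: "real mat"
  assumes K: "K \<in> carrier_mat m n"
    and zero: "\<And>y. y \<in> carrier_vec n \<Longrightarrow> K *\<^sub>v y = 0\<^sub>v m"
  shows "K = 0\<^sub>m m n"
proof (rule eq_matI)
  fix i j
  assume "i < dim_row (0\<^sub>m m n :: real mat)" "j < dim_col (0\<^sub>m m n :: real mat)"
  then have ij: "i < m" "j < n"
    by auto
  then have "(K *\<^sub>v unit_vec n j) $ i = K $$ (i, j)"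
    using K by simp
  then show "K $$ (i, j) = 0\<^sub>m m n $$ (i, j)"
    using zero[of "unit_vec n j"] ij by simp
qed (use K in auto)

text \<open>The form is the sum of \<open>Q\<close> evaluated at \<open>K y\<close> and the identity
  evaluated at \<open>H y\<close>. Both are positive definite, so the sum is nonnegative and
  vanishes only if both arguments do.\<close>

lemma coupling_form:
  assumes Q: "pos_def_mat m Q"
    and K: "K \<in> carrier_mat m n" and H: "H \<in> carrier_mat k n" and y: "y \<in> carrier_vec n"
  shows "y \<bullet> ((K\<^sup>T * Q * K + H\<^sup>T * H) *\<^sub>v y) \<ge> 0"
    and "y \<bullet> ((K\<^sup>T * Q * K + H\<^sup>T * H) *\<^sub>v y) = 0 \<longleftrightarrow> K *\<^sub>v y = 0\<^sub>v m \<and> H *\<^sub>v y = 0\<^sub>v k"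
proof -
  have Qc: "Q \<in> carrier_mat m m"
    using Q by (simp add: pos_def_mat_def sym_mat_def)
  have carr: "K *\<^sub>v y \<in> carrier_vec m" "H *\<^sub>v y \<in> carrier_vec k"
    using K H y by auto
  have "K\<^sup>T * Q * K \<in> carrier_mat n n" "H\<^sup>T * H \<in> carrier_mat n n" "H\<^sup>T * 1\<^sub>m k = H\<^sup>T"
    using K H Qc by (auto intro!: right_mult_one_mat)
  then have eq: "y \<bullet> ((K\<^sup>T * Q * K + H\<^sup>T * H) *\<^sub>v y)
      = (K *\<^sub>v y) \<bullet> (Q *\<^sub>v (K *\<^sub>v y)) + (H *\<^sub>v y) \<bullet> (1\<^sub>m k *\<^sub>v (H *\<^sub>v y))"
    using y scalar_prod_congruence[OF K Qc y] scalar_prod_congruence[OF H one_carrier_mat y]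
    by (simp add: quadratic_form_linear[of _ n])
  have nonneg: "0 \<le> (K *\<^sub>v y) \<bullet> (Q *\<^sub>v (K *\<^sub>v y))" "0 \<le> (H *\<^sub>v y) \<bullet> (1\<^sub>m k *\<^sub>v (H *\<^sub>v y))"
    using carr pos_def_mat_nonneg Q pos_def_one_mat by blast+
  have zero: "x \<bullet> (P *\<^sub>v x) = 0 \<longleftrightarrow> x = 0\<^sub>v r"
    if "pos_def_mat r P" "x \<in> carrier_vec r" for r P x
    using that by (cases "x = 0\<^sub>v r") (auto simp: pos_def_mat_def sym_mat_def)
  show "y \<bullet> ((K\<^sup>T * Q * K + H\<^sup>T * H) *\<^sub>v y) \<ge> 0"
    using eq nonneg by linarith
  show "y \<bullet> ((K\<^sup>T * Q * K + H\<^sup>T * H) *\<^sub>v y) = 0 \<longleftrightarrow> K *\<^sub>v y = 0\<^sub>v m \<and> H *\<^sub>v y = 0\<^sub>v k"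
    unfolding eq add_nonneg_eq_0_iff[OF nonneg]
    using zero[OF Q carr(1)] zero[OF pos_def_one_mat carr(2)] by simp
qed

section \<open>The convexity criterion and its three instances\<close>

text \<open>Case (c) for an arbitrary family of nonnegative reals \<open>lam\<close>; the graph
  enters only later, to supply this nonnegativity.\<close>

lemma convex_V_M_c_iff:
  assumes lam: "\<And>i. i < N \<Longrightarrow> 0 \<le> lam i"
    and B: "Bd \<in> carrier_mat m n" "Bc \<in> carrier_mat m n"
    and D: "Dd \<in> carrier_mat k n" "Dc \<in> carrier_mat k n"
    and Q: "pos_def_mat m Q"
    and Z: "\<And>i. i < N \<Longrightarrow> Z i \<in> carrier_mat n n"
  shows "(\<forall>i<N. \<forall>y\<in>carrier_vec n. convex_on {0..1} (\<lambda>p. V (M_c Bd Bc Dd Dc Q (Z i) (lam i)) p y)) \<longleftrightarrow>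
    (Bc = 0\<^sub>m m n \<and> Dc = 0\<^sub>m k n) \<or> (\<forall>i<N. lam i \<noteq> 0 \<longrightarrow> 2 \<le> lam i)"
proof -
  let ?s = "\<lambda>y. y \<bullet> ((Bc\<^sup>T * Q * Bc + Dc\<^sup>T * Dc) *\<^sub>v y)"
  have Qc: "Q \<in> carrier_mat m m"
    using Q by (simp add: pos_def_mat_def sym_mat_def)
  have convex_iff: "convex_on {0..1} (\<lambda>p. V (M_c Bd Bc Dd Dc Q (Z i) (lam i)) p y)
      \<longleftrightarrow> ?s y = 0 \<or> lam i = 0 \<or> 2 \<le> lam i"
    if i: "i < N" and y: "y \<in> carrier_vec n" for i y
  proof -
    obtain a b where "\<And>p. V (M_c Bd Bc Dd Dc Q (Z i) (lam i)) p y
        = a + b * p + lam i * (lam i - 2) * ?s y * p\<^sup>2"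
      using V_M_c_quadratic[OF B D Qc Z[OF i] y] by blast
    then have "convex_on {0..1} (\<lambda>p. V (M_c Bd Bc Dd Dc Q (Z i) (lam i)) p y)
        \<longleftrightarrow> 0 \<le> lam i * (lam i - 2) * ?s y"
      by (simp add: convex_on_quadratic_iff)
    \<comment> \<open>As \<open>lam i\<close> and \<open>?s y\<close> are nonnegative, the product
      can be negative only if \<open>0 < lam i\<close>, \<open>lam i < 2\<close> and
      \<open>?s y > 0\<close>.\<close>
    also have "\<dots> \<longleftrightarrow> ?s y = 0 \<or> lam i = 0 \<or> 2 \<le> lam i"
      using lam[OF i] coupling_form(1)[OF Q B(2) D(2) y]
      by (auto simp: zero_le_mult_iff mult_le_0_iff)
    finally show ?thesis .
  qed
  have "(\<forall>y\<in>carrier_vec n. ?s y = 0) \<longleftrightarrow> Bc = 0\<^sub>m m n \<and> Dc = 0\<^sub>m k n"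
    using coupling_form(2)[OF Q B(2) D(2)] eq_zero_mat_if_mult_vec_zero[OF B(2)]
      eq_zero_mat_if_mult_vec_zero[OF D(2)]
    by auto
  \<comment> \<open>In \<open>convex_iff\<close> the first disjunct depends only on \<open>y\<close>
    and the others only on \<open>i\<close>, so the two universal quantifiers separate across the
    disjunction.\<close>
  then show ?thesis
    using convex_iff by blast
qed

lemma M_b_eq_M_c: "M_b Ad Ac Cd Cc Q = M_c Ad Ac Cd Cc Q Q"
  by (simp add: fun_eq_iff M_b_def M_c_def)

lemma M_a_eq_M_c:
  assumes "Ad \<in> carrier_mat n n" "Ac \<in> carrier_mat n n" "Q \<in> carrier_mat n n"
  shows "M_a Ad Ac Q = M_c Ad Ac (0\<^sub>m 0 n) (0\<^sub>m 0 n) Q Q"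
proof -
  \<comment> \<open>With inner dimension 0, every entry of the product is an empty sum, so the
    output terms become the \<open>n\<close> by \<open>n\<close> zero matrix.\<close>
  have "0\<^sub>m 0 n + r \<cdot>\<^sub>m 0\<^sub>m 0 n = (0\<^sub>m 0 n :: real mat)"
    "(0\<^sub>m 0 n)\<^sup>T * 0\<^sub>m 0 n = (0\<^sub>m n n :: real mat)" for r
    by (auto simp: scalar_prod_def)
  moreover have "(Ad + r \<cdot>\<^sub>m Ac)\<^sup>T * Q * (Ad + r \<cdot>\<^sub>m Ac) \<in> carrier_mat n n"
    "Ac\<^sup>T * Q * Ac \<in> carrier_mat n n" for r
    using assms by auto
  ultimately show ?thesis
    by (simp add: fun_eq_iff M_a_def M_c_def)
qed

theorem lemma8:
  fixes N nx nw nz :: nat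
    and G :: "nat pair_pre_digraph"
    and lam :: "nat \<Rightarrow> real"
    and Ad Ac Bd Bc Cd Cc Dd Dc Q :: "real mat"
    and Z :: "nat \<Rightarrow> real mat"
  assumes graph: "pair_graph G" "pverts G = {..<N}"
    and eigenvalues: "char_poly (laplacian N G) = (\<Prod>i<N. [:- lam i, 1:])"
    and A: "Ad \<in> carrier_mat nx nx" "Ac \<in> carrier_mat nx nx"
    and B: "Bd \<in> carrier_mat nx nw" "Bc \<in> carrier_mat nx nw"
    and C: "Cd \<in> carrier_mat nz nx" "Cc \<in> carrier_mat nz nx"
    and D: "Dd \<in> carrier_mat nz nw" "Dc \<in> carrier_mat nz nw"
    and Q: "pos_def_mat nx Q"
    and Z: "\<And>i. i < N \<Longrightarrow> sym_mat nw (Z i)"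
  shows "((\<forall>i<N. \<forall>y\<in>carrier_vec nx. convex_on {0..1} (\<lambda>p. V (M_a Ad Ac Q (lam i)) p y)) \<longleftrightarrow>
           Ac = 0\<^sub>m nx nx \<or> (\<forall>i<N. lam i \<noteq> 0 \<longrightarrow> 2 \<le> lam i))
       \<and> ((\<forall>i<N. \<forall>y\<in>carrier_vec nx. convex_on {0..1} (\<lambda>p. V (M_b Ad Ac Cd Cc Q (lam i)) p y)) \<longleftrightarrow>
           (Ac = 0\<^sub>m nx nx \<and> Cc = 0\<^sub>m nz nx) \<or> (\<forall>i<N. lam i \<noteq> 0 \<longrightarrow> 2 \<le> lam i))
       \<and> ((\<forall>i<N. \<forall>y\<in>carrier_vec nw. convex_on {0..1} (\<lambda>p. V (M_c Bd Bc Dd Dc Q (Z i) (lam i)) p y)) \<longleftrightarrow>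
           (Bc = 0\<^sub>m nx nw \<and> Dc = 0\<^sub>m nz nw) \<or> (\<forall>i<N. lam i \<noteq> 0 \<longrightarrow> 2 \<le> lam i))"
proof -
  have lam: "0 \<le> lam i" if "i < N" for i
  proof (rule eigenvalue_laplacian_nonneg[OF graph])
    have "laplacian N G \<in> carrier_mat N N"
      by (simp add: laplacian_def)
    \<comment> \<open>Each \<open>lam i\<close> is a root of its own linear factor, hence an
      eigenvalue.\<close>
    moreover have "poly (char_poly (laplacian N G)) (lam i) = 0"
      unfolding eigenvalues using that by (auto simp: poly_prod)
    ultimately show "eigenvalue (laplacian N G) (lam i)"
      by (simp add: eigenvalue_root_char_poly)
  qed
  have Qc: "Q \<in> carrier_mat nx nx"
    using Q by (simp add: pos_def_mat_def sym_mat_def)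
  have Zc: "Z i \<in> carrier_mat nw nw" if "i < N" for i
    using Z[OF that] by (simp add: sym_mat_def)
  have zero: "0\<^sub>m 0 nx \<in> carrier_mat 0 nx"
    by simp
  \<comment> \<open>For (a), the condition on the coupling output matrix reads
    \<open>0\<^sub>m 0 nx = 0\<^sub>m 0 nx\<close> and disappears. For (a) and (b), the family
    \<open>Z\<close> is constantly \<open>Q\<close>.\<close>
  show ?thesis
    using convex_V_M_c_iff[OF lam A zero zero Q, where N = N and Z = "\<lambda>_. Q"]
      convex_V_M_c_iff[OF lam A C Q, where N = N and Z = "\<lambda>_. Q"]
      convex_V_M_c_iff[OF lam B D Q Zc, where N = N] Qc
    by (simp add: M_a_eq_M_c[OF A Qc] M_b_eq_M_c)
qed

end
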